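(* Let $(W,S)$ be a Coxeter system with $S$ finite. Let $x\in W$ and let $T=T(x^{-1})$. Then $x$ is ultra low if and only if $\Phi^1(x)=\partial T$. Moreover, if $\Phi^1(x)=\partial T$ then $x$ is the gate of $X_T$.
   Context: $\ell$ is the length function; $x\preccurlyeq y$ means $\ell(x^{-1}y)=\ell(y)-\ell(x)$. The cone type of $x\in W$ is $T(x)=\{y\in W\mid\ell(xy)=\ell(x)+\ell(y)\}$; for a cone type $T$, $X_T=\{w\in W\mid T(w^{-1})=T\}$. A gate of a set $X\subseteq W$ is an element $g\in X$ with $g\preccurlyeq y$ for all $y\in X$ (unique if it exists). Root system: $V$ is the real vector space with basis $\{\alpha_s\mid s\in S\}$ and form $\langle\alpha_s,\alpha_t\rangle=-\cos(\pi/m_{s,t})$ ($m_{s,t}$ the order of $st$; value $-1$ if $m_{s,t}=\infty$); $W$ acts by $s\lambda=\lambda-2\langle\lambda,\alpha_s\rangle\alpha_s$; $\Phi=\{w\alpha_s\mid w\in W,s\in S\}$; $\Phi^+$ is the set of roots that are non-negative combinations of the $\alpha_s$ ($\alpha<0$ means $-\alpha\in\Phi^+$). For $\beta=w\alpha_s$, $s_\beta=wsw^{-1}$. $\Phi(w)=\{\alpha\in\Phi^+\mid w^{-1}\alpha<0\}$ and $\Phi^1(w)=\{\beta\in\Phi^+\mid\ell(s_\beta w)=\ell(w)-1\}$. Boundary roots: for a cone type $T$, $\partial T$ is the set of $\beta\in\Phi^+$ such that there exist $w\in W$ and $s\in S$ with $w\notin T$ and $s_\beta w=ws\in T$. An element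 $x\in W$ is ultra low if for each $\beta\in\Phi^1(x)$ there exists $w\in W$ such that $\Phi(x)\cap\Phi(w)=\{\beta\}$. *)

theory Defs
  imports Complex_Main "HOL-Algebra.Multiplicative_Group" "HOL-Algebra.Generated_Groups"
begin

section \<open>Coxeter systems\<close>

definition word_prod :: "('a, 'b) monoid_scheme \<Rightarrow> 'a list \<Rightarrow> 'a" where
  "word_prod W ws = foldr (\<lambda>s w. s \<otimes>\<^bsub>W\<^esub> w) ws \<one>\<^bsub>W\<^esub>"

definition alt_word :: "nat \<Rightarrow> 'a \<Rightarrow> 'a \<Rightarrow> 'a list" where
  "alt_word m s t = concat (replicate m [s, t])"

text \<open>
  The congruence on words in \<open>S\<close> generated by the relations
  \<open>(s t) ^ m(s,t) = 1\<close>, where \<open>m(s,t)\<close> is the order of \<open>s t\<close> in \<open>W\<close>. The library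
  order of an element of infinite order is \<open>0\<close>, and then the relation below is the
  trivial one. When the elements of \<open>S\<close> are involutions the relations with \<open>s = t\<close> read
  \<open>s s = 1\<close>, so the quotient monoid is already the group presented by these generators
  and relations and formal inverses are not needed.
\<close>

inductive coxeter_equiv :: "('a, 'b) monoid_scheme \<Rightarrow> 'a set \<Rightarrow> 'a list \<Rightarrow> 'a list \<Rightarrow> bool"
  for W :: "('a, 'b) monoid_scheme" and S :: "'a set" where
  rel: "\<lbrakk>u \<in> lists S; v \<in> lists S; s \<in> S; t \<in> S\<rbrakk>
    \<Longrightarrow> coxeter_equiv W S (u @ alt_word (group.ord W (s \<otimes>\<^bsub>W\<^esub> t)) s t @ v) (u @ v)"
| refl: "u \<in> lists S \<Longrightarrow> coxeter_equiv W S u u"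
| sym: "coxeter_equiv W S u v \<Longrightarrow> coxeter_equiv W S v u"
| trans: "\<lbrakk>coxeter_equiv W S u v; coxeter_equiv W S v w\<rbrakk> \<Longrightarrow> coxeter_equiv W S u w"

locale coxeter_system = group W for W (structure) +
  fixes S :: "'a set"
  assumes S_subset: "S \<subseteq> carrier W"
    and S_order: "s \<in> S \<Longrightarrow> ord s = 2"
    and S_generates: "generate W S = carrier W"
    and S_presentation: "\<lbrakk>u \<in> lists S; v \<in> lists S; word_prod W u = word_prod W v\<rbrakk>
      \<Longrightarrow> coxeter_equiv W S u v"
begin

definition len :: "'a \<Rightarrow> nat" where
  "len w = (LEAST n. \<exists>ws\<in>lists S. word_prod W ws = w \<and> length ws = n)"

definition weak_le :: "'a \<Rightarrow> 'a \<Rightarrow> bool" where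
  "weak_le x y \<longleftrightarrow> int (len (inv x \<otimes> y)) = int (len y) - int (len x)"

definition cone_type :: "'a \<Rightarrow> 'a set" where
  "cone_type x = {y \<in> carrier W. len (x \<otimes> y) = len x + len y}"

definition X_part :: "'a set \<Rightarrow> 'a set" where
  "X_part T = {w \<in> carrier W. cone_type (inv w) = T}"

text \<open>A set has at most one gate, since \<^const>\<open>weak_le\<close> is antisymmetric on \<open>W\<close>.\<close>

definition is_gate :: "'a \<Rightarrow> 'a set \<Rightarrow> bool" where
  "is_gate g X \<longleftrightarrow> g \<in> X \<and> (\<forall>y\<in>X. weak_le g y)"

section \<open>The root system\<close>

text \<open>
  Vectors are finitely supported functions \<open>'a \<Rightarrow> real\<close> vanishing outside \<open>S\<close>, the
  value at \<open>s\<close> being the coefficient of \<open>\<alpha>\<^sub>s\<close>. The value \<open>0\<close> of \<^const>\<open>ord\<close> encodes infinite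
  order; for \<open>s = t\<close> the order is \<open>1\<close> and the form has value \<open>1\<close>.
\<close>

definition simple_root :: "'a \<Rightarrow> 'a \<Rightarrow> real" where
  "simple_root s = (\<lambda>t. if t = s then 1 else 0)"

definition form_coeff :: "'a \<Rightarrow> 'a \<Rightarrow> real" where
  "form_coeff s t = (if ord (s \<otimes> t) = 0 then - 1 else - cos (pi / real (ord (s \<otimes> t))))"

definition form :: "('a \<Rightarrow> real) \<Rightarrow> ('a \<Rightarrow> real) \<Rightarrow> real" where
  "form u v = (\<Sum>s | u s \<noteq> 0. \<Sum>t | v t \<noteq> 0. u s * v t * form_coeff s t)"

definition simple_reflection :: "'a \<Rightarrow> ('a \<Rightarrow> real) \<Rightarrow> ('a \<Rightarrow> real)" where
  "simple_reflection s v = (\<lambda>t. v t - 2 * form v (simple_root s) * simple_root s t)"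

text \<open>
  The action of \<open>w\<close> is the composite of the simple reflections along a word for \<open>w\<close>.
  The choice of the word is immaterial, because the simple reflections satisfy the
  defining relations of \<open>W\<close>.
\<close>

definition act :: "'a \<Rightarrow> ('a \<Rightarrow> real) \<Rightarrow> ('a \<Rightarrow> real)" where
  "act w = foldr simple_reflection (SOME ws. ws \<in> lists S \<and> word_prod W ws = w)"

definition roots :: "('a \<Rightarrow> real) set" where
  "roots = {act w (simple_root s) | w s. w \<in> carrier W \<and> s \<in> S}"

definition pos_roots :: "('a \<Rightarrow> real) set" where
  "pos_roots = {\<beta> \<in> roots. \<forall>s\<in>S. 0 \<le> \<beta> s}"

definition neg_root :: "('a \<Rightarrow> real) \<Rightarrow> bool" where
  "neg_root \<beta> \<longleftrightarrow> (\<lambda>s. - \<beta> s) \<in> pos_roots"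

text \<open>
  The reflection \<open>w s w\<^sup>-\<^sup>1\<close> depends only on the root \<open>w \<alpha>\<^sub>s\<close>, because the action on
  the root space is faithful.
\<close>

definition root_reflection :: "('a \<Rightarrow> real) \<Rightarrow> 'a" where
  "root_reflection \<beta> = (THE r. \<exists>w\<in>carrier W. \<exists>s\<in>S.
     \<beta> = act w (simple_root s) \<and> r = w \<otimes> s \<otimes> inv w)"

definition inversions :: "'a \<Rightarrow> ('a \<Rightarrow> real) set" where
  "inversions w = {\<alpha> \<in> pos_roots. neg_root (act (inv w) \<alpha>)}"

definition short_inversions :: "'a \<Rightarrow> ('a \<Rightarrow> real) set" where
  "short_inversions w =
     {\<beta> \<in> pos_roots. int (len (root_reflection \<beta> \<otimes> w)) = int (len w) - 1}"

definition boundary_roots :: "'a set \<Rightarrow> ('a \<Rightarrow> real) set" where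
  "boundary_roots T = {\<beta> \<in> pos_roots. \<exists>w\<in>carrier W. \<exists>s\<in>S.
     w \<notin> T \<and> root_reflection \<beta> \<otimes> w = w \<otimes> s \<and> w \<otimes> s \<in> T}"

definition ultra_low :: "'a \<Rightarrow> bool" where
  "ultra_low x \<longleftrightarrow> (\<forall>\<beta>\<in>short_inversions x. \<exists>w\<in>carrier W. inversions x \<inter> inversions w = {\<beta>})"

end

end

theory Submission
  imports Defs
begin

text \<open>
  The length formula \<open>\<ell>(x\<^sup>-\<^sup>1 y) = \<ell>(x) + \<ell>(y) - 2 |\<Phi>(x) \<inter> \<Phi>(y)|\<close> turns everything into statements on
  inversion sets: \<open>T(x\<^sup>-\<^sup>1)\<close> consists of the \<open>y\<close> with \<open>\<Phi>(x) \<inter> \<Phi>(y) = \<emptyset>\<close>, and \<open>x \<preceq> y\<close> means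
  \<open>\<Phi>(x) \<subseteq> \<Phi>(y)\<close>. Crossing a single wall shows that \<open>\<beta> \<in> \<partial>T(x\<^sup>-\<^sup>1)\<close> holds exactly if
  \<open>\<Phi>(x) \<inter> \<Phi>(w) = {\<beta>}\<close> for some \<open>w\<close>; then \<open>\<ell>(x\<^sup>-\<^sup>1 w) = \<ell>(x) + \<ell>(w) - 2\<close>, which together with
  \<open>x\<^sup>-\<^sup>1 w = (s\<^sub>\<beta> x)\<^sup>-\<^sup>1 (s\<^sub>\<beta> w)\<close> forces \<open>\<beta> \<in> \<Phi>\<^sup>1(x)\<close>. Hence \<open>\<partial>T(x\<^sup>-\<^sup>1) \<subseteq> \<Phi>\<^sup>1(x)\<close> always, with equality
  exactly for ultra low \<open>x\<close>.

  For the gate property it remains to see that \<open>\<Phi>\<^sup>1(x) \<subseteq> \<Phi>(y)\<close> implies \<open>\<Phi>(x) \<subseteq> \<Phi>(y)\<close>. A linear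
  functional divided by the height attains its maximum over \<open>\<Phi>(x)\<close> at a short inversion of \<open>x\<close>;
  this is applied to the functional \<open>\<alpha> \<mapsto> ht(y\<^sup>-\<^sup>1 \<alpha>)\<close>, whose sign decides membership in \<open>\<Phi>(y)\<close>.
\<close>

section \<open>Words and the geometric representation\<close>

text \<open>The Chebyshev recursion with free initial values; from 0 and 1 it yields the polynomials
  of the second kind, shifted by one. It governs coordinates under a dihedral group.\<close>

fun cheb :: "real \<Rightarrow> real \<Rightarrow> real \<Rightarrow> nat \<Rightarrow> real" where
  "cheb c a b 0 = a"
| "cheb c a b (Suc 0) = b"
| "cheb c a b (Suc (Suc n)) = 2 * c * cheb c a b (Suc n) - cheb c a b n"

text \<open>The factor sin \<theta> avoids a division. The difference \<open>real n - 1\<close> is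
  taken in the reals, so the case n = 0 is covered too.\<close>

lemma sin_times_cheb:
  "sin \<theta> * cheb (cos \<theta>) a b n = b * sin (real n * \<theta>) - a * sin ((real n - 1) * \<theta>)"
proof (induction "cos \<theta>" a b n rule: cheb.induct)
  case (3 a b n)
  have sin_step: "sin ((r + 2) * \<theta>) = 2 * cos \<theta> * sin ((r + 1) * \<theta>) - sin (r * \<theta>)" for r
  proof -
    have "sin ((r + 2) * \<theta>) = sin ((r + 1) * \<theta> + \<theta>)" "sin (r * \<theta>) = sin ((r + 1) * \<theta> - \<theta>)"
      by (simp_all add: algebra_simps)
    then show ?thesis
      unfolding sin_add sin_diff by simp
  qed
  have "sin \<theta> * cheb (cos \<theta>) a b (Suc (Suc n)) =
      2 * cos \<theta> * (sin \<theta> * cheb (cos \<theta>) a b (Suc n)) - sin \<theta> * cheb (cos \<theta>) a b n"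
    by (simp add: algebra_simps)
  also have "\<dots> = b * sin ((real n + 2) * \<theta>) - a * sin ((real n - 1 + 2) * \<theta>)"
    unfolding 3 sin_step by (simp add: algebra_simps)
  finally show ?case by (simp add: algebra_simps)
qed simp_all

text \<open>The degenerate angle 0, where the sine formula reads 0 = 0. It serves the pairs s, t
  with st of infinite order.\<close>

lemma cheb_one: "cheb 1 0 1 n = real n"
  by (induction "1::real" "0::real" "1::real" n rule: cheb.induct) simp_all

text \<open>The word grows at its left end and, if nonempty, ends in t, because the letters of a
  word act from the right.\<close>

fun alternating :: "'a \<Rightarrow> 'a \<Rightarrow> nat \<Rightarrow> 'a list" where
  "alternating s t 0 = []"
| "alternating s t (Suc n) = (if even n then t else s) # alternating s t n"

lemma length_alternating [simp]: "length (alternating s t n) = n"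
  by (induction n) auto

lemma set_alternating: "set (alternating s t n) \<subseteq> {s, t}"
  by (induction n) auto

lemma alternating_snoc: "alternating s t n @ [s] = alternating t s (Suc n)"
  by (induction n) auto

lemma alternating_split: "k \<le> n \<Longrightarrow> \<exists>us. set us \<subseteq> {s, t} \<and> length us = n - k \<and> alternating s t n = us @ alternating s t k"
proof (induction n)
  case (Suc n)
  show ?case
  proof (cases "k = Suc n")
    case True
    then show ?thesis by (intro exI[of _ "[]"]) auto
  next
    case False
    with Suc obtain us where "set us \<subseteq> {s, t}" "length us = n - k" "alternating s t n = us @ alternating s t k"
      by (metis le_SucE)
    with False Suc.prems show ?thesis
      by (intro exI[of _ "(if even n then t else s) # us"]) auto
  qed
qed auto

lemma alt_word_eq_alternating: "alt_word m s t = alternating s t (2 * m)"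
proof -
  have "concat (replicate m [s, t]) = alternating s t (2 * m)"
    by (induction m) auto
  then show ?thesis by (simp add: alt_word_def)
qed

definition lincomb :: "real \<Rightarrow> ('a \<Rightarrow> real) \<Rightarrow> real \<Rightarrow> ('a \<Rightarrow> real) \<Rightarrow> 'a \<Rightarrow> real" where
  "lincomb a u b v = (\<lambda>t. a * u t + b * v t)"

section \<open>The bilinear form and the simple reflections\<close>

locale finite_rank_coxeter_system = coxeter_system +
  assumes finite_S: "finite S"
begin

text \<open>As S is finite, this is the root space with the simple roots as basis; for other
  functions the sums in \<open>form\<close> may range over infinite sets.\<close>

definition V :: "('a \<Rightarrow> real) set" where
  "V = {v. \<forall>t. t \<notin> S \<longrightarrow> v t = 0}"

lemma S_carrier [simp]: "s \<in> S \<Longrightarrow> s \<in> carrier W"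
  using S_subset by auto

lemma S_square [simp]:
  assumes "s \<in> S" shows "s \<otimes> s = \<one>"
proof -
  have "s [^] (2::nat) = \<one>"
    using pow_ord_eq_1[of s] S_order assms by simp
  then show ?thesis using assms by (simp add: numeral_2_eq_2)
qed

lemma S_inv [simp]: "s \<in> S \<Longrightarrow> inv s = s"
  by (simp add: inv_equality)

lemma S_cancel_left [simp]: "s \<in> S \<Longrightarrow> w \<in> carrier W \<Longrightarrow> s \<otimes> (s \<otimes> w) = w"
  by (simp add: m_assoc[symmetric])

lemma S_cancel_right [simp]: "s \<in> S \<Longrightarrow> w \<in> carrier W \<Longrightarrow> w \<otimes> s \<otimes> s = w"
  by (simp add: m_assoc)

lemma inv_cancel_left [simp]:
  assumes "u \<in> carrier W" "w \<in> carrier W"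
  shows "inv u \<otimes> (u \<otimes> w) = w" "u \<otimes> (inv u \<otimes> w) = w"
  using assms by (simp_all add: m_assoc[symmetric])

lemma S_inj_mult [simp]: "s \<in> S \<Longrightarrow> t \<in> S \<Longrightarrow> s \<otimes> t = \<one> \<longleftrightarrow> s = t"
  by (metis S_carrier S_cancel_left S_square r_one)

lemma form_coeff_commute:
  assumes "s \<in> S" "t \<in> S" shows "form_coeff s t = form_coeff t s"
proof -
  have "t \<otimes> s = inv (s \<otimes> t)" using assms by (simp add: inv_mult_group)
  then have "ord (t \<otimes> s) = ord (s \<otimes> t)" using assms by (simp add: ord_inv)
  then show ?thesis by (simp add: form_coeff_def)
qed

lemma form_coeff_self [simp]: "s \<in> S \<Longrightarrow> form_coeff s s = 1"
  by (simp add: form_coeff_def)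

lemma lincomb_V [simp]: "u \<in> V \<Longrightarrow> v \<in> V \<Longrightarrow> lincomb a u b v \<in> V"
  by (simp add: V_def lincomb_def)

lemma simple_root_V [simp]: "s \<in> S \<Longrightarrow> simple_root s \<in> V"
  by (auto simp: V_def simple_root_def)

lemma form_eq:
  assumes "u \<in> V" "v \<in> V"
  shows "form u v = (\<Sum>s\<in>S. \<Sum>t\<in>S. u s * v t * form_coeff s t)"
proof -
  have "(\<Sum>t | v t \<noteq> 0. u s * v t * form_coeff s t) = (\<Sum>t\<in>S. u s * v t * form_coeff s t)" for s
    using assms finite_S by (intro sum.mono_neutral_left) (auto simp: V_def)
  moreover have "(\<Sum>s | u s \<noteq> 0. \<Sum>t\<in>S. u s * v t * form_coeff s t) =
      (\<Sum>s\<in>S. \<Sum>t\<in>S. u s * v t * form_coeff s t)"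
    using assms finite_S by (intro sum.mono_neutral_left) (auto simp: V_def)
  ultimately show ?thesis by (simp add: form_def)
qed

lemma form_commute: "u \<in> V \<Longrightarrow> v \<in> V \<Longrightarrow> form u v = form v u"
  unfolding form_eq
  by (subst sum.swap) (auto intro!: sum.cong simp: form_coeff_commute)

lemma form_lincomb_left:
  "u \<in> V \<Longrightarrow> v \<in> V \<Longrightarrow> w \<in> V \<Longrightarrow> form (lincomb a u b v) w = a * form u w + b * form v w"
  by (simp add: form_eq) (simp add: lincomb_def sum_distrib_left sum.distrib algebra_simps)

lemma form_lincomb_right:
  "u \<in> V \<Longrightarrow> v \<in> V \<Longrightarrow> w \<in> V \<Longrightarrow> form w (lincomb a u b v) = a * form w u + b * form w v"
  by (simp add: form_eq) (simp add: lincomb_def sum_distrib_left sum.distrib algebra_simps)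

lemma form_simple_root:
  assumes "s \<in> S" "t \<in> S" shows "form (simple_root s) (simple_root t) = form_coeff s t"
proof -
  have "form (simple_root s) (simple_root t) =
      (\<Sum>a\<in>S. \<Sum>b\<in>S. if b = t then (if a = s then form_coeff a b else 0) else 0)"
    using assms by (simp add: form_eq) (auto simp: simple_root_def intro!: sum.cong)
  then show ?thesis using assms finite_S by simp
qed

lemma simple_reflection_eq:
  "simple_reflection s v = lincomb 1 v (- 2 * form v (simple_root s)) (simple_root s)"
  by (simp add: simple_reflection_def lincomb_def)

lemma simple_reflection_V [simp]: "s \<in> S \<Longrightarrow> v \<in> V \<Longrightarrow> simple_reflection s v \<in> V"
  by (simp add: simple_reflection_eq)

lemma simple_reflection_lincomb:
  "s \<in> S \<Longrightarrow> u \<in> V \<Longrightarrow> v \<in> V \<Longrightarrow>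
    simple_reflection s (lincomb a u b v) = lincomb a (simple_reflection s u) b (simple_reflection s v)"
  by (simp add: simple_reflection_def form_lincomb_left) (simp add: lincomb_def fun_eq_iff algebra_simps)

lemma form_simple_reflection:
  "s \<in> S \<Longrightarrow> u \<in> V \<Longrightarrow> v \<in> V \<Longrightarrow> form (simple_reflection s u) (simple_reflection s v) = form u v"
  by (simp add: simple_reflection_eq form_lincomb_left form_lincomb_right form_simple_root
      form_commute[of "simple_root s" v])

lemma simple_reflection_simple_reflection [simp]:
  "s \<in> S \<Longrightarrow> v \<in> V \<Longrightarrow> simple_reflection s (simple_reflection s v) = v"
  by (simp add: simple_reflection_eq form_lincomb_left form_simple_root)
    (simp add: lincomb_def fun_eq_iff)

lemma simple_reflection_self: "s \<in> S \<Longrightarrow> simple_reflection s (simple_root s) = (\<lambda>t. - simple_root s t)"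
  by (simp add: simple_reflection_def form_simple_root fun_eq_iff)

section \<open>Action of words and the Coxeter relations\<close>

abbreviation word_act :: "'a list \<Rightarrow> ('a \<Rightarrow> real) \<Rightarrow> 'a \<Rightarrow> real" where
  "word_act \<equiv> foldr simple_reflection"

lemma word_act_V [simp]: "ws \<in> lists S \<Longrightarrow> v \<in> V \<Longrightarrow> word_act ws v \<in> V"
  by (induction ws) auto

lemma word_act_lincomb:
  "ws \<in> lists S \<Longrightarrow> u \<in> V \<Longrightarrow> v \<in> V \<Longrightarrow>
    word_act ws (lincomb a u b v) = lincomb a (word_act ws u) b (word_act ws v)"
  by (induction ws) (auto simp: simple_reflection_lincomb)

lemma form_word_act:
  "ws \<in> lists S \<Longrightarrow> u \<in> V \<Longrightarrow> v \<in> V \<Longrightarrow> form (word_act ws u) (word_act ws v) = form u v"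
  by (induction ws) (auto simp: form_simple_reflection)

lemma alternating_lists: "s \<in> S \<Longrightarrow> t \<in> S \<Longrightarrow> alternating s t n \<in> lists S"
  using set_alternating[of s t n] by auto

text \<open>Each letter changes only its own coordinate, to 2c times the other one minus the old
  value. So the two coordinates are consecutive terms of the recursion, and the parity of n tells
  which is the newer.\<close>

lemma word_act_alternating:
  assumes "s \<in> S" "t \<in> S" "c = - form_coeff s t"
  shows "word_act (alternating s t n) (lincomb p (simple_root s) q (simple_root t)) =
    (if even n then lincomb (cheb c q p (Suc n)) (simple_root s) (cheb c q p n) (simple_root t)
     else lincomb (cheb c q p n) (simple_root s) (cheb c q p (Suc n)) (simple_root t))"
proof (induction n)
  case (Suc n)
  have "simple_reflection s (lincomb p (simple_root s) q (simple_root t)) =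
      lincomb (2 * c * q - p) (simple_root s) q (simple_root t)"
    "simple_reflection t (lincomb p (simple_root s) q (simple_root t)) =
      lincomb p (simple_root s) (2 * c * p - q) (simple_root t)" for p q
    using assms
    by (simp_all add: simple_reflection_eq form_lincomb_left form_simple_root form_coeff_commute[of t s])
      (simp_all add: lincomb_def fun_eq_iff algebra_simps)
  with Suc show ?case by simp
qed simp

text \<open>For distinct s, t with finite order m the two simple roots span a nondegenerate plane.
  The component of v in it is rotated by a full turn; the orthogonal component is fixed by both
  reflections.\<close>

lemma word_act_relation:
  assumes st: "s \<in> S" "t \<in> S" and v: "v \<in> V"
  shows "word_act (alt_word (ord (s \<otimes> t)) s t) v = v"
proof -
  let ?m = "ord (s \<otimes> t)"
  consider "?m = 0" | "s = t" | "s \<noteq> t" "?m \<ge> 2"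
    by (metis One_nat_def S_inj_mult S_carrier less_2_cases m_closed not_le ord_eq_1 st)
  then show ?thesis
  proof cases
    case 1
    then show ?thesis by (simp add: alt_word_def)
  next
    case 2
    then show ?thesis using st v by (simp add: alt_word_def)
  next
    case 3
    define \<theta> where "\<theta> = pi / real ?m"
    define c where "c = cos \<theta>"
    have c: "c = - form_coeff s t" using 3 by (simp add: c_def \<theta>_def form_coeff_def)
    have sin_pos: "sin \<theta> > 0"
      using 3 by (intro sin_gt_zero) (auto simp: \<theta>_def field_simps)
    have sin_sq: "1 - c\<^sup>2 = (sin \<theta>)\<^sup>2" by (simp add: c_def sin_squared_eq)
    then have nz: "1 - c\<^sup>2 \<noteq> 0" using sin_pos by simp
    define a b where "a = form v (simple_root s)" and "b = form v (simple_root t)"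
    \<comment> \<open>Solution of the 2 by 2 Gram system: d has the same products with both simple
      roots as v, so v0 is orthogonal to them.\<close>
    define p q where "p = (a + c * b) / (1 - c\<^sup>2)" and "q = (b + c * a) / (1 - c\<^sup>2)"
    define d where "d = lincomb p (simple_root s) q (simple_root t)"
    define v0 where "v0 = lincomb 1 v (- 1) d"
    have pq: "p - c * q = a" "q - c * p = b"
      using nz by (simp_all add: p_def q_def divide_simps) (simp_all add: power2_eq_square algebra_simps)
    have V: "d \<in> V" "v0 \<in> V" using st v by (simp_all add: d_def v0_def)
    have "form v0 (simple_root s) = 0" "form v0 (simple_root t) = 0"
      using st v V pq c
      by (simp_all add: v0_def form_lincomb_left d_def form_simple_root form_coeff_commute[of t s] a_def b_def
          algebra_simps)
    then have "simple_reflection s v0 = v0" "simple_reflection t v0 = v0"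
      by (simp_all add: simple_reflection_def)
    then have fix0: "word_act (alternating s t n) v0 = v0" for n
      by (induction n) auto
    \<comment> \<open>The 2m letters shift the angle by 2 pi, so the recursion returns to its
      initial values.\<close>
    have m\<theta>: "real ?m * \<theta> = pi" using 3 by (simp add: \<theta>_def)
    have "sin (real (2 * ?m) * \<theta>) = 0" "sin ((real (2 * ?m) - 1) * \<theta>) = - sin \<theta>"
      "sin (real (Suc (2 * ?m)) * \<theta>) = sin \<theta>"
    proof -
      have 1: "real (2 * ?m) * \<theta> = 2 * pi" "(real (2 * ?m) - 1) * \<theta> = 2 * pi - \<theta>"
        "real (Suc (2 * ?m)) * \<theta> = \<theta> + 2 * pi" using m\<theta> by (simp_all add: algebra_simps)
      show "sin (real (2 * ?m) * \<theta>) = 0" "sin ((real (2 * ?m) - 1) * \<theta>) = - sin \<theta>"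
        "sin (real (Suc (2 * ?m)) * \<theta>) = sin \<theta>"
        unfolding 1 by (simp_all add: sin_diff sin_add)
    qed
    then have "sin \<theta> * cheb c q p (2 * ?m) = sin \<theta> * q" "sin \<theta> * cheb c q p (Suc (2 * ?m)) = sin \<theta> * p"
      unfolding c_def sin_times_cheb by (simp_all add: algebra_simps)
    then have "cheb c q p (2 * ?m) = q" "cheb c q p (Suc (2 * ?m)) = p"
      using sin_pos by simp_all
    then have "word_act (alternating s t (2 * ?m)) d = d"
      using word_act_alternating[OF st c, of "2 * ?m" p q] by (simp add: d_def)
    moreover have "v = lincomb 1 v0 1 d" by (simp add: v0_def lincomb_def fun_eq_iff)
    ultimately show ?thesis
      using word_act_lincomb[OF alternating_lists[OF st] V(2) V(1)] fix0 by (simp add: alt_word_eq_alternating)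
  qed
qed

text \<open>Each relator has even length and acts trivially. Parity will control how the length
  changes; the other half makes the action independent of the word.\<close>

lemma coxeter_equiv_sound:
  assumes "coxeter_equiv W S u v"
  shows "even (length u) = even (length v) \<and> (\<forall>x\<in>V. word_act u x = word_act v x)"
  using assms
proof induction
  case (rel u v s t)
  then show ?case
    by (simp add: word_act_relation) (simp add: alt_word_eq_alternating)
qed auto

section \<open>Length\<close>

lemma word_prod_Nil [simp]: "word_prod W [] = \<one>"
  and word_prod_Cons [simp]: "word_prod W (s # ws) = s \<otimes> word_prod W ws"
  by (simp_all add: word_prod_def)

lemma word_prod_closed [simp]: "ws \<in> lists S \<Longrightarrow> word_prod W ws \<in> carrier W"
  by (induction ws) auto

lemma word_prod_append [simp]:
  "us \<in> lists S \<Longrightarrow> vs \<in> lists S \<Longrightarrow> word_prod W (us @ vs) = word_prod W us \<otimes> word_prod W vs"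
  by (induction us) (auto simp: m_assoc)

lemma word_prod_rev: "ws \<in> lists S \<Longrightarrow> word_prod W (rev ws) = inv (word_prod W ws)"
proof (induction ws)
  case (Cons s ws)
  then have "rev ws \<in> lists S" "[s] \<in> lists S" "ws \<in> lists S" by auto
  with Cons show ?case
    using word_prod_append[of "rev ws" "[s]"] word_prod_closed[of ws] by (simp add: inv_mult_group)
qed simp

lemma word_exists:
  assumes "w \<in> carrier W"
  shows "\<exists>ws\<in>lists S. word_prod W ws = w"
  using assms unfolding S_generates[symmetric]
proof induction
  case one
  show ?case by (intro bexI[of _ "[]"]) auto
next
  case (incl h)
  then show ?case by (intro bexI[of _ "[h]"]) auto
next
  case (inv h)
  then show ?case by (intro bexI[of _ "[h]"]) auto
next
  case (eng h1 h2)
  then obtain us vs where "us \<in> lists S" "vs \<in> lists S" "word_prod W us = h1" "word_prod W vs = h2"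
    by blast
  then show ?case by (intro bexI[of _ "us @ vs"]) auto
qed

lemma reduced_word:
  assumes "w \<in> carrier W"
  obtains ws where "ws \<in> lists S" "word_prod W ws = w" "length ws = len w"
proof -
  have "\<exists>n. \<exists>ws\<in>lists S. word_prod W ws = w \<and> length ws = n"
    using word_exists[OF assms] by blast
  from LeastI_ex[OF this] show ?thesis using that unfolding len_def by blast
qed

lemma len_word_prod_le: "ws \<in> lists S \<Longrightarrow> len (word_prod W ws) \<le> length ws"
  unfolding len_def by (rule Least_le) blast

lemma len_word_prod_parity:
  assumes "ws \<in> lists S"
  shows "even (len (word_prod W ws)) = even (length ws)"
proof -
  obtain us where "us \<in> lists S" "word_prod W us = word_prod W ws" "length us = len (word_prod W ws)"
    using reduced_word assms word_prod_closed by metis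
  then show ?thesis
    using coxeter_equiv_sound[OF S_presentation] assms by metis
qed

lemma len_mult_le: "u \<in> carrier W \<Longrightarrow> v \<in> carrier W \<Longrightarrow> len (u \<otimes> v) \<le> len u + len v"
  by (metis append_in_lists_conv len_word_prod_le length_append reduced_word word_prod_append)

lemma len_one [simp]: "len \<one> = 0"
  using len_word_prod_le[of "[]"] by simp

lemma len_S_le: "s \<in> S \<Longrightarrow> len s \<le> 1"
  using len_word_prod_le[of "[s]"] by simp

lemma len_inv [simp]:
  assumes "w \<in> carrier W" shows "len (inv w) = len w"
proof -
  have "len (inv w) \<le> len w" if "w \<in> carrier W" for w
    using that by (metis reduced_word word_prod_rev len_word_prod_le length_rev in_lists_conv_set set_rev)
  from this[OF assms] this[OF inv_closed[OF assms]] assms show ?thesis by simp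
qed

text \<open>One letter changes the length by at most one, and parity excludes equality.\<close>

lemma len_mult_S:
  assumes "w \<in> carrier W" "s \<in> S"
  shows "len (w \<otimes> s) = Suc (len w) \<or> len w = Suc (len (w \<otimes> s))"
proof -
  obtain ws where ws: "ws \<in> lists S" "word_prod W ws = w" "length ws = len w"
    using reduced_word assms by metis
  have "even (len (w \<otimes> s)) = even (Suc (len w))"
    using len_word_prod_parity[of "ws @ [s]"] ws assms by simp
  moreover have "len (w \<otimes> s) \<le> len w + 1"
    using len_mult_le[of w s] len_S_le[of s] assms by simp
  moreover have "len w \<le> len (w \<otimes> s) + 1"
    using len_mult_le[of "w \<otimes> s" s] len_S_le[of s] assms by simp
  ultimately show ?thesis by presburger
qed

lemma descent_exists:
  assumes "w \<in> carrier W" "w \<noteq> \<one>"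
  obtains s where "s \<in> S" "len w = Suc (len (w \<otimes> s))"
proof -
  obtain ws where ws: "ws \<in> lists S" "word_prod W ws = w" "length ws = len w"
    using reduced_word assms by metis
  with assms(2) obtain us s where us: "ws = us @ [s]"
    by (cases ws rule: rev_cases) auto
  with ws have s: "us \<in> lists S" "s \<in> S" "w = word_prod W us \<otimes> s" by auto
  then have "len (w \<otimes> s) < len w"
    using len_word_prod_le[of us] ws us by simp
  with len_mult_S[OF assms(1) s(2)] s(2) that show ?thesis by fastforce
qed

text \<open>Every nontrivial element has a right descent, so each element arises by appending
  letters that increase the length.\<close>

lemma len_induct [consumes 1, case_names one mult]:
  assumes "w \<in> carrier W" and "P \<one>"
    and step: "\<And>w s. w \<in> carrier W \<Longrightarrow> s \<in> S \<Longrightarrow> len (w \<otimes> s) = Suc (len w) \<Longrightarrow> P w \<Longrightarrow> P (w \<otimes> s)"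
  shows "P w"
  using assms(1)
proof (induction "len w" arbitrary: w)
  case 0
  then show ?case using assms(2) descent_exists by (metis nat.distinct(1))
next
  case (Suc n)
  then have "w \<noteq> \<one>" by auto
  with Suc obtain s where s: "s \<in> S" "len w = Suc (len (w \<otimes> s))"
    using descent_exists by metis
  with Suc have "P (w \<otimes> s)" by simp
  from step[OF _ s(1) _ this] s Suc.prems show ?case by simp
qed

section \<open>The action of the group on the root space\<close>

text \<open>The word picked by \<open>SOME\<close> has the same product as ws, so the two are
  equivalent by the presentation and act alike.\<close>

lemma act_word_prod:
  assumes "ws \<in> lists S" "v \<in> V"
  shows "act (word_prod W ws) v = word_act ws v"
proof -
  let ?us = "SOME us. us \<in> lists S \<and> word_prod W us = word_prod W ws"
  have "?us \<in> lists S \<and> word_prod W ?us = word_prod W ws"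
    by (rule someI[of _ ws]) (use assms in simp)
  then show ?thesis
    using coxeter_equiv_sound[OF S_presentation, of ?us ws] assms by (simp add: act_def)
qed

lemma act_V [simp]: "w \<in> carrier W \<Longrightarrow> v \<in> V \<Longrightarrow> act w v \<in> V"
  using word_exists act_word_prod word_act_V by metis

lemma act_one [simp]: "v \<in> V \<Longrightarrow> act \<one> v = v"
  using act_word_prod[of "[]"] by simp

lemma act_S: "s \<in> S \<Longrightarrow> v \<in> V \<Longrightarrow> act s v = simple_reflection s v"
  using act_word_prod[of "[s]"] by simp

lemma act_mult:
  assumes "x \<in> carrier W" "y \<in> carrier W" "v \<in> V"
  shows "act (x \<otimes> y) v = act x (act y v)"
proof -
  obtain us vs where "us \<in> lists S" "vs \<in> lists S" "word_prod W us = x" "word_prod W vs = y"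
    using word_exists assms by metis
  then show ?thesis
    using act_word_prod[of "us @ vs"] act_word_prod[of us] act_word_prod[of vs] assms by auto
qed

lemma act_inv_act [simp]: "x \<in> carrier W \<Longrightarrow> v \<in> V \<Longrightarrow> act (inv x) (act x v) = v"
  by (simp add: act_mult[symmetric])

lemma act_act_inv [simp]: "x \<in> carrier W \<Longrightarrow> v \<in> V \<Longrightarrow> act x (act (inv x) v) = v"
  by (simp add: act_mult[symmetric])

lemma act_lincomb:
  "w \<in> carrier W \<Longrightarrow> u \<in> V \<Longrightarrow> v \<in> V \<Longrightarrow> act w (lincomb a u b v) = lincomb a (act w u) b (act w v)"
  by (metis word_exists act_word_prod word_act_lincomb lincomb_V)

lemma form_act: "w \<in> carrier W \<Longrightarrow> u \<in> V \<Longrightarrow> v \<in> V \<Longrightarrow> form (act w u) (act w v) = form u v"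
  by (metis word_exists act_word_prod form_word_act)

lemma neg_eq_lincomb: "(\<lambda>t. - v t) = lincomb (- 1) v 0 v"
  by (simp add: lincomb_def)

lemma act_neg: "w \<in> carrier W \<Longrightarrow> v \<in> V \<Longrightarrow> act w (\<lambda>t. - v t) = (\<lambda>t. - act w v t)"
  using act_lincomb[of w v v "- 1" 0] by (simp add: neg_eq_lincomb[of v] neg_eq_lincomb[of "act w v"])

section \<open>Roots are positive or negative\<close>

text \<open>In the relator of 2m letters the last m + 1 give the inverse of the first m - 1. So a
  suffix of m + 1 letters has length at most m - 1, and the other n - m letters keep the total below
  n.\<close>

lemma len_alternating_le:
  assumes "s \<in> S" "t \<in> S" "ord (s \<otimes> t) \<noteq> 0" "ord (s \<otimes> t) \<le> n"
  shows "len (word_prod W (alternating t s (Suc n))) < n"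
proof -
  let ?m = "ord (s \<otimes> t)"
  have ts: "ord (t \<otimes> s) = ?m"
    using assms ord_inv[of "s \<otimes> t"] by (simp add: inv_mult_group)
  have rel: "word_prod W (alternating t s (2 * k)) = (t \<otimes> s) [^] k" for k
  proof -
    have "word_prod W (concat (replicate k [t, s])) = (t \<otimes> s) [^] k"
    proof (induction k)
      case (Suc k)
      then show ?case using assms nat_pow_Suc2[of "t \<otimes> s" k] by (simp add: m_assoc del: nat_pow_Suc)
    qed simp
    then show ?thesis using alt_word_eq_alternating[of k t s] by (simp add: alt_word_def)
  qed
  have lists: "alternating t s k \<in> lists S" for k using assms by (intro alternating_lists)
  have "Suc ?m \<le> 2 * ?m" "Suc ?m \<le> Suc n" using assms by auto
  then obtain us vs where us: "set us \<subseteq> {t, s}" "length us = 2 * ?m - Suc ?m"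
    "alternating t s (2 * ?m) = us @ alternating t s (Suc ?m)"
    and vs: "set vs \<subseteq> {t, s}" "length vs = Suc n - Suc ?m"
    "alternating t s (Suc n) = vs @ alternating t s (Suc ?m)"
    using alternating_split[of "Suc ?m" "2 * ?m" t s] alternating_split[of "Suc ?m" "Suc n" t s] by metis
  have l: "us \<in> lists S" "vs \<in> lists S" using us vs assms by auto
  let ?a = "word_prod W (alternating t s (Suc ?m))"
  have a: "?a \<in> carrier W" using lists by (rule word_prod_closed)
  have "word_prod W us \<otimes> ?a = \<one>"
    using rel[of ?m] us(3) l lists[of "Suc ?m"] ts assms pow_ord_eq_1[of "t \<otimes> s"]
    by (metis S_carrier m_closed word_prod_append)
  then have "?a = inv (word_prod W us)"
    using a l by (metis inv_equality inv_inv word_prod_closed inv_closed)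
  then have "len ?a \<le> ?m - 1"
    using len_word_prod_le[OF l(1)] us(2) l by simp
  moreover have "len (word_prod W (alternating t s (Suc n))) \<le> (n - ?m) + len ?a"
    using len_mult_le[of "word_prod W vs" ?a] len_word_prod_le[OF l(2)] vs(2,3) l a lists[of "Suc ?m"]
    by (simp del: alternating.simps)
  ultimately show ?thesis using assms by linarith
qed

text \<open>Humphreys, Section 5.4: split off the longest alternating suffix in \<open>s\<close> and \<open>t\<close>, where \<open>t\<close> is
  a right descent of \<open>w\<close>.\<close>

lemma act_simple_root_nonneg:
  assumes "w \<in> carrier W" "s \<in> S" "len w < len (w \<otimes> s)"
  shows "0 \<le> act w (simple_root s) r"
  using assms
proof (induction "len w" arbitrary: w s r rule: less_induct)
  case less
  show ?case
  proof (cases "w = \<one>")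
    case True
    then show ?thesis using less by (simp, simp add: simple_root_def)
  next
    case False
    then obtain t where t: "t \<in> S" "len w = Suc (len (w \<otimes> t))"
      using descent_exists less.prems by metis
    define P where "P n \<longleftrightarrow> (\<exists>v\<in>carrier W. w = v \<otimes> word_prod W (alternating s t n) \<and> len w = len v + n)" for n
    have "P 1" unfolding P_def using t less.prems by (intro bexI[of _ "w \<otimes> t"]) auto
    moreover have bound: "n \<le> len w" if "P n" for n using that unfolding P_def by auto
    ultimately obtain n where n: "P n" "n \<ge> 1" "\<not> P (Suc n)"
      by (metis GreatestI_nat Greatest_le_nat not_less_eq_eq order_refl)
    obtain v where v: "v \<in> carrier W" "w = v \<otimes> word_prod W (alternating s t n)" "len w = len v + n"
      using n(1) unfolding P_def by blast
    obtain k where k: "n = Suc k" using n(2) by (cases n) auto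
    have lists: "alternating s t j \<in> lists S" for j using t less.prems by (intro alternating_lists)
    define r0 r1 where "r0 = (if even k then t else s)" and "r1 = (if even n then t else s)"
    have r: "r0 \<in> S" "r1 \<in> S" "{r0, r1} = {s, t}"
      using t less.prems by (auto simp: r0_def r1_def k)
    \<comment> \<open>Otherwise r1 could be split off v too, and the suffix would not be the
      longest.\<close>
    have "len v < len (v \<otimes> r1)"
    proof (rule ccontr)
      assume "\<not> ?thesis"
      with len_mult_S[OF v(1) r(2)] have "len v = Suc (len (v \<otimes> r1))" by linarith
      moreover have "w = (v \<otimes> r1) \<otimes> word_prod W (alternating s t (Suc n))"
        using v r lists[of n] by (simp add: m_assoc r1_def[symmetric])
      ultimately have "P (Suc n)" using v r unfolding P_def by (intro bexI[of _ "v \<otimes> r1"]) auto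
      with n show False by simp
    qed
    \<comment> \<open>Here r0 is the first letter of the suffix: a descent of v at r0 would cancel
      it and give w too short an expression.\<close>
    moreover have "len v < len (v \<otimes> r0)"
    proof (rule ccontr)
      assume "\<not> ?thesis"
      with len_mult_S[OF v(1) r(1)] have "len v = Suc (len (v \<otimes> r0))" by linarith
      moreover have "w = (v \<otimes> r0) \<otimes> word_prod W (alternating s t k)"
        using v r lists[of k] by (simp add: m_assoc r0_def[symmetric] k)
      ultimately show False
        using len_mult_le[of "v \<otimes> r0" "word_prod W (alternating s t k)"] len_word_prod_le[OF lists[of k]]
          lists[of k] v r k by simp
    qed
    ultimately have "len v < len (v \<otimes> s)" "len v < len (v \<otimes> t)" using r(3) by (auto simp: doubleton_eq_iff)
    moreover have "len v < len w" using v k by simp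
    ultimately have nonneg: "0 \<le> act v (simple_root s) r" "0 \<le> act v (simple_root t) r"
      using less.hyps v(1) t(1) less.prems(2) by blast+
    have s: "s \<in> S" using less.prems by simp
    define m where "m = ord (s \<otimes> t)"
    \<comment> \<open>A suffix of n \<ge> m letters with m nonzero would make ws shorter than
      w.\<close>
    have m: "m = 0 \<or> n < m"
    proof (rule ccontr)
      assume "\<not> ?thesis"
      then have "len (word_prod W (alternating s t n @ [s])) < n"
        using len_alternating_le[OF s t(1), of n] by (simp add: m_def alternating_snoc)
      moreover have "w \<otimes> s = v \<otimes> word_prod W (alternating s t n @ [s])"
        using v s lists[of n] by (simp add: m_assoc)
      ultimately have "len (w \<otimes> s) < len w"
        using len_mult_le[of v "word_prod W (alternating s t n @ [s])"] v s lists[of n] by simp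
      with less.prems show False by simp
    qed
    define c where "c = - form_coeff s t"
    \<comment> \<open>For m nonzero, j \<le> n + 1 \<le> m keeps j * \<theta> in [0, pi], where the
      sine is non-negative.\<close>
    have cheb: "0 \<le> cheb c 0 1 j" if "j \<le> Suc n" for j
    proof (cases "m = 0")
      case True
      then have "c = 1" by (simp add: c_def form_coeff_def m_def)
      then show ?thesis by (simp add: cheb_one)
    next
      case False
      with m k have m2: "n < m" "m \<ge> 2" by auto
      define \<theta> where "\<theta> = pi / real m"
      have c: "c = cos \<theta>" using False by (simp add: c_def form_coeff_def m_def \<theta>_def)
      have "sin \<theta> > 0" using m2 by (intro sin_gt_zero) (auto simp: \<theta>_def field_simps)
      moreover have "sin (real j * \<theta>) \<ge> 0"
        using m2 that by (intro sin_ge_zero) (auto simp: \<theta>_def field_simps)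
      ultimately show ?thesis
        using sin_times_cheb[of \<theta> 0 1 j] unfolding c by (metis add_diff_cancel_right' diff_zero
            mult_1 mult_zero_left zero_le_mult_iff not_less)
    qed
    have w_act: "act w (simple_root s) = act v (word_act (alternating s t n) (lincomb 1 (simple_root s) 0 (simple_root t)))"
      using v lists s by (simp add: act_mult act_word_prod) (simp add: lincomb_def)
    show ?thesis
      unfolding w_act using nonneg cheb[of n] cheb[of "Suc n"] v s t
      by (simp only: word_act_alternating[OF s t(1) c_def]) (simp add: act_lincomb, simp add: lincomb_def del: cheb.simps)
  qed
qed

section \<open>Signs of roots\<close>

lemma act_mult_S_simple_root:
  "w \<in> carrier W \<Longrightarrow> s \<in> S \<Longrightarrow> act (w \<otimes> s) (simple_root s) = (\<lambda>t. - act w (simple_root s) t)"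
  by (simp add: act_mult act_S simple_reflection_self act_neg)

lemma rootE:
  assumes "\<beta> \<in> roots"
  obtains w s where "w \<in> carrier W" "s \<in> S" "\<beta> = act w (simple_root s)"
  using assms by (auto simp: roots_def)

lemma act_simple_root_in_roots [simp]:
  "w \<in> carrier W \<Longrightarrow> s \<in> S \<Longrightarrow> act w (simple_root s) \<in> roots"
  by (auto simp: roots_def)

lemma roots_V [simp]: "\<beta> \<in> roots \<Longrightarrow> \<beta> \<in> V"
  by (auto simp: roots_def)

lemma pos_roots_subset: "\<beta> \<in> pos_roots \<Longrightarrow> \<beta> \<in> roots"
  by (simp add: pos_roots_def)

lemma pos_roots_V [simp]: "\<beta> \<in> pos_roots \<Longrightarrow> \<beta> \<in> V"
  by (simp add: pos_roots_def)

lemma form_root: "\<beta> \<in> roots \<Longrightarrow> form \<beta> \<beta> = 1"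
  by (erule rootE) (simp add: form_act form_simple_root)

lemma act_roots [simp]: "w \<in> carrier W \<Longrightarrow> \<beta> \<in> roots \<Longrightarrow> act w \<beta> \<in> roots"
  by (erule rootE) (simp add: act_mult[symmetric])

lemma neg_roots: "\<beta> \<in> roots \<Longrightarrow> (\<lambda>t. - \<beta> t) \<in> roots"
  by (erule rootE) (simp add: act_mult_S_simple_root[symmetric])

lemma root_nonzero:
  assumes "\<beta> \<in> roots" shows "\<exists>t\<in>S. \<beta> t \<noteq> 0"
proof (rule ccontr)
  assume "\<not> ?thesis"
  then have "form \<beta> \<beta> = 0" using assms by (simp add: form_eq)
  then show False using form_root assms by simp
qed

lemma pos_or_neg_root:
  assumes "\<beta> \<in> roots" shows "\<beta> \<in> pos_roots \<or> neg_root \<beta>"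
proof -
  obtain w s where w: "w \<in> carrier W" "s \<in> S" "\<beta> = act w (simple_root s)"
    using assms by (rule rootE)
  from len_mult_S[OF w(1,2)] show ?thesis
  proof
    assume "len (w \<otimes> s) = Suc (len w)"
    then have "\<beta> \<in> pos_roots"
      using act_simple_root_nonneg[OF w(1,2)] w assms by (simp add: pos_roots_def)
    then show ?thesis ..
  next
    assume "len w = Suc (len (w \<otimes> s))"
    then have "\<forall>t. 0 \<le> act (w \<otimes> s) (simple_root s) t"
      using act_simple_root_nonneg[of "w \<otimes> s" s] w by simp
    then have "neg_root \<beta>"
      using w assms neg_roots by (simp add: neg_root_def pos_roots_def act_mult_S_simple_root)
    then show ?thesis ..
  qed
qed

lemma neg_root_iff: "neg_root \<beta> \<longleftrightarrow> \<beta> \<in> roots \<and> \<beta> \<notin> pos_roots"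
proof -
  have "\<beta> \<in> roots \<and> \<beta> \<notin> pos_roots" if "neg_root \<beta>"
  proof -
    from that have *: "(\<lambda>t. - \<beta> t) \<in> roots" "\<forall>t\<in>S. \<beta> t \<le> 0"
      by (simp_all add: neg_root_def pos_roots_def)
    from neg_roots[OF *(1)] have "\<beta> \<in> roots" by simp
    with root_nonzero[OF this] *(2) show ?thesis
      by (force simp: pos_roots_def)
  qed
  then show ?thesis using pos_or_neg_root by blast
qed

text \<open>If ws is shorter than w, non-negativity applied to ws makes -w \<alpha>_s positive, and
  no root is both positive and negative.\<close>

lemma act_simple_root_pos_iff:
  assumes "w \<in> carrier W" "s \<in> S"
  shows "act w (simple_root s) \<in> pos_roots \<longleftrightarrow> len (w \<otimes> s) = Suc (len w)"
proof -
  have pos: "act w (simple_root s) \<in> pos_roots"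
    if "w \<in> carrier W" "len (w \<otimes> s) = Suc (len w)" for w
    using act_simple_root_nonneg[of w s] that assms by (simp add: pos_roots_def)
  have "len (w \<otimes> s) = Suc (len w)" if "act w (simple_root s) \<in> pos_roots"
  proof (rule ccontr)
    assume "\<not> ?thesis"
    with len_mult_S assms have "len w = Suc (len (w \<otimes> s))" by blast
    with pos[of "w \<otimes> s"] assms have "neg_root (act w (simple_root s))"
      by (simp add: neg_root_def act_mult_S_simple_root)
    with that show False by (simp add: neg_root_iff)
  qed
  with pos assms show ?thesis by blast
qed

lemma simple_root_pos [simp]: "s \<in> S \<Longrightarrow> simple_root s \<in> pos_roots"
  using act_simple_root_pos_iff[of \<one> s] len_mult_S[of \<one> s] by simp

text \<open>Roots have norm 1, so the factor is 1 or -1, and -1 would make \<gamma>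
  negative.\<close>

lemma pos_root_multiple:
  assumes "\<beta> \<in> pos_roots" "\<gamma> \<in> pos_roots" "\<And>t. \<beta> t = a * \<gamma> t"
  shows "\<beta> = \<gamma>"
proof -
  have \<beta>: "\<beta> = lincomb a \<gamma> 0 \<gamma>" using assms(3) by (simp add: lincomb_def fun_eq_iff)
  have "form \<beta> \<beta> = a * a * form \<gamma> \<gamma>"
    using assms(2) unfolding \<beta> by (simp add: form_lincomb_left form_lincomb_right)
  then have "a * a = 1" using assms pos_roots_subset form_root by simp
  then have "a = 1 \<or> a = - 1" by (metis mult_1 square_eq_iff mult_minus_left)
  moreover have "a \<noteq> - 1"
  proof
    assume "a = - 1"
    with assms(3) have "\<beta> = (\<lambda>t. - \<gamma> t)" by (simp add: fun_eq_iff)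
    with assms(1) have "neg_root \<gamma>" by (simp add: neg_root_def)
    then show False using assms neg_root_iff by blast
  qed
  ultimately show ?thesis using assms(3) by (simp add: fun_eq_iff)
qed

lemma pos_root_other_coordinate:
  assumes "\<beta> \<in> pos_roots" "s \<in> S" "\<beta> \<noteq> simple_root s"
  obtains t where "t \<in> S" "t \<noteq> s" "\<beta> t > 0"
proof -
  have "\<exists>t\<in>S. t \<noteq> s \<and> \<beta> t \<noteq> 0"
  proof (rule ccontr)
    assume "\<not> ?thesis"
    moreover have "\<beta> t = 0" if "t \<notin> S" for t
      using pos_roots_V[OF assms(1)] that by (simp add: V_def)
    ultimately have "\<beta> t = \<beta> s * simple_root s t" for t
      by (cases "t \<in> S") (auto simp: simple_root_def)
    then have "\<beta> = simple_root s"
      by (rule pos_root_multiple[OF assms(1) simple_root_pos[OF assms(2)]])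
    with assms(3) show False ..
  qed
  then show ?thesis using that assms(1) by (force simp: pos_roots_def)
qed

text \<open>The reflection changes only the coordinate at s, and a positive root other than
  \<alpha>_s has a positive coordinate elsewhere.\<close>

lemma act_S_pos:
  assumes "s \<in> S" "\<beta> \<in> pos_roots" "\<beta> \<noteq> simple_root s"
  shows "act s \<beta> \<in> pos_roots"
proof -
  obtain t where t: "t \<in> S" "t \<noteq> s" "\<beta> t > 0"
    using pos_root_other_coordinate assms by metis
  then have "act s \<beta> t > 0"
    using assms by (simp add: act_S) (simp add: simple_reflection_def simple_root_def)
  then have "\<not> neg_root (act s \<beta>)"
    using t by (force simp: neg_root_def pos_roots_def)
  then show ?thesis using assms pos_roots_subset neg_root_iff by simp
qed

section \<open>Faithfulness and the reflections attached to roots\<close>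

lemma act_reflection:
  assumes "w \<in> carrier W" "s \<in> S" "v \<in> V" "\<beta> = act w (simple_root s)"
  shows "act (w \<otimes> s \<otimes> inv w) v = lincomb 1 v (- 2 * form v \<beta>) \<beta>"
proof -
  have "form (act (inv w) v) (simple_root s) = form v \<beta>"
    using form_act[of w "act (inv w) v" "simple_root s"] assms by simp
  then show ?thesis
    using assms by (simp add: act_mult act_S simple_reflection_eq act_lincomb)
qed

text \<open>An element that fixes every simple root has no right descent, hence is trivial.\<close>

lemma act_faithful:
  assumes "x \<in> carrier W" "y \<in> carrier W" "\<And>v. v \<in> V \<Longrightarrow> act x v = act y v"
  shows "x = y"
proof -
  let ?w = "inv x \<otimes> y"
  have w: "?w \<in> carrier W" using assms by simp
  have "act ?w v = v" if "v \<in> V" for v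
    using assms(1,2) that by (simp add: act_mult assms(3)[symmetric])
  then have "len (?w \<otimes> s) = Suc (len ?w)" if "s \<in> S" for s
    using act_simple_root_pos_iff[OF w that] that by simp
  then have "?w = \<one>"
    using descent_exists[OF w] by (metis n_not_Suc_n Suc_n_not_n less_SucI lessI not_less_iff_gr_or_eq)
  then show ?thesis
    using assms by (metis inv_comm inv_equality inv_inv inv_closed)
qed

text \<open>Any way of writing \<beta> as w \<alpha>_s gives an element acting by v -
  2<v,\<beta>>\<beta>, which involves only \<beta>; faithfulness then makes the value of
  \<open>THE\<close> unique.\<close>

lemma root_reflection_act:
  assumes "w \<in> carrier W" "s \<in> S" "\<beta> = act w (simple_root s)"
  shows "root_reflection \<beta> = w \<otimes> s \<otimes> inv w"
  unfolding root_reflection_def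
proof (rule the_equality)
  show "\<exists>w'\<in>carrier W. \<exists>s'\<in>S. \<beta> = act w' (simple_root s') \<and> w \<otimes> s \<otimes> inv w = w' \<otimes> s' \<otimes> inv w'"
    using assms by blast
next
  fix r
  assume "\<exists>w'\<in>carrier W. \<exists>s'\<in>S. \<beta> = act w' (simple_root s') \<and> r = w' \<otimes> s' \<otimes> inv w'"
  then obtain w' s' where w': "w' \<in> carrier W" "s' \<in> S" "\<beta> = act w' (simple_root s')"
    "r = w' \<otimes> s' \<otimes> inv w'" by blast
  show "r = w \<otimes> s \<otimes> inv w"
    by (rule act_faithful) (use assms w' in \<open>simp_all only: act_reflection[OF assms(1,2) _ assms(3)]
      act_reflection[OF w'(1,2) _ w'(3)] w'(4) m_closed inv_closed S_carrier\<close>)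
qed

lemma root_reflection_closed [simp]: "\<beta> \<in> roots \<Longrightarrow> root_reflection \<beta> \<in> carrier W"
  by (erule rootE) (simp add: root_reflection_act)

lemma root_reflection_cancel [simp]:
  assumes "\<beta> \<in> roots" "w \<in> carrier W"
  shows "root_reflection \<beta> \<otimes> (root_reflection \<beta> \<otimes> w) = w"
proof -
  obtain u s where u: "u \<in> carrier W" "s \<in> S" "\<beta> = act u (simple_root s)"
    using assms(1) by (rule rootE)
  then show ?thesis using assms(2) by (simp add: root_reflection_act m_assoc)
qed

lemma act_root_reflection:
  assumes "\<beta> \<in> roots" "v \<in> V"
  shows "act (root_reflection \<beta>) v = lincomb 1 v (- 2 * form v \<beta>) \<beta>"
  using assms(1) by (rule rootE) (simp add: root_reflection_act act_reflection[OF _ _ assms(2)])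

lemma act_root_reflection_self:
  assumes "\<beta> \<in> roots" shows "act (root_reflection \<beta>) \<beta> = (\<lambda>t. - \<beta> t)"
  using assms by (simp add: act_root_reflection form_root) (simp add: lincomb_def)

lemma root_reflection_inj:
  assumes "\<beta> \<in> pos_roots" "\<gamma> \<in> pos_roots" "root_reflection \<beta> = root_reflection \<gamma>"
  shows "\<beta> = \<gamma>"
proof (rule pos_root_multiple[OF assms(1,2)])
  have "(\<lambda>t. - \<beta> t) = lincomb 1 \<beta> (- 2 * form \<beta> \<gamma>) \<gamma>"
    using act_root_reflection_self[of \<beta>] act_root_reflection[of \<gamma> \<beta>] assms pos_roots_subset by simp
  then show "\<beta> t = form \<beta> \<gamma> * \<gamma> t" for t
    by (simp add: lincomb_def fun_eq_iff)
qed

section \<open>Inversion sets\<close>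

lemma inversions_iff:
  assumes "w \<in> carrier W"
  shows "\<alpha> \<in> inversions w \<longleftrightarrow> \<alpha> \<in> pos_roots \<and> act (inv w) \<alpha> \<notin> pos_roots"
  using assms pos_roots_subset by (auto simp: inversions_def neg_root_iff)

lemma inversions_one [simp]: "inversions \<one> = {}"
  by (auto simp: inversions_iff)

lemma act_simple_root_not_inversion:
  "w \<in> carrier W \<Longrightarrow> s \<in> S \<Longrightarrow> act w (simple_root s) \<notin> inversions w"
  by (simp add: inversions_iff)

text \<open>The reflection s permutes the positive roots other than \<alpha>_s, so applying s to
  w^-1 \<alpha> changes its sign only if w^-1 \<alpha> is \<alpha>_s or its negative.\<close>

lemma inversions_mult_S:
  assumes w: "w \<in> carrier W" and s: "s \<in> S" and len: "len (w \<otimes> s) = Suc (len w)"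
  shows "inversions (w \<otimes> s) = insert (act w (simple_root s)) (inversions w)"
proof -
  have \<gamma>: "act w (simple_root s) \<in> pos_roots" using act_simple_root_pos_iff assms by blast
  have "\<alpha> \<in> inversions (w \<otimes> s) \<longleftrightarrow> \<alpha> = act w (simple_root s) \<or> \<alpha> \<in> inversions w"
    if \<alpha>: "\<alpha> \<in> pos_roots" for \<alpha>
  proof -
    let ?\<delta> = "act (inv w) \<alpha>"
    have \<delta>: "?\<delta> \<in> roots" using w \<alpha> pos_roots_subset by simp
    have iff: "\<alpha> \<in> inversions (w \<otimes> s) \<longleftrightarrow> act s ?\<delta> \<notin> pos_roots"
      using w s \<alpha> by (simp add: inversions_iff inv_mult_group act_mult)
    have \<alpha>_eq: "\<alpha> = act w ?\<delta>" using w \<alpha> by simp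
    consider "?\<delta> = simple_root s" | "?\<delta> \<in> pos_roots" "?\<delta> \<noteq> simple_root s" | "?\<delta> \<notin> pos_roots"
      by blast
    then show ?thesis
    proof cases
      case 1
      then have "neg_root (act s ?\<delta>)"
        using s by (simp add: act_S simple_reflection_self neg_root_def)
      with 1 \<alpha>_eq iff show ?thesis by (simp add: neg_root_iff)
    next
      case 2
      then have "\<alpha> \<noteq> act w (simple_root s)" using w s by auto
      with 2 act_S_pos[OF s 2] iff w show ?thesis by (simp add: inversions_iff)
    next
      case 3
      let ?\<epsilon> = "\<lambda>t. - ?\<delta> t"
      have \<epsilon>: "?\<epsilon> \<in> pos_roots" using 3 \<delta> neg_root_iff neg_root_def by blast
      \<comment> \<open>This would give \<alpha> = -w \<alpha>_s, a negative root.\<close>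
      have "?\<epsilon> \<noteq> simple_root s"
      proof
        assume "?\<epsilon> = simple_root s"
        then have "act w (simple_root s) = (\<lambda>t. - \<alpha> t)"
          using act_neg[OF w, of ?\<delta>] \<delta> \<alpha>_eq by simp
        with \<gamma> have "neg_root \<alpha>" by (simp add: neg_root_def)
        with \<alpha> show False by (simp add: neg_root_iff)
      qed
      from act_S_pos[OF s \<epsilon> this] have "neg_root (act s ?\<delta>)"
        using s \<delta> by (simp add: neg_root_def act_neg)
      with 3 iff w \<alpha> show ?thesis by (simp add: inversions_iff neg_root_iff)
    qed
  qed
  with \<gamma> w s show ?thesis by (auto simp: inversions_iff)
qed

lemma finite_inversions [simp]: "w \<in> carrier W \<Longrightarrow> finite (inversions w)"
  by (induction rule: len_induct) (simp_all add: inversions_mult_S)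

lemma card_inversions: "w \<in> carrier W \<Longrightarrow> card (inversions w) = len w"
  by (induction rule: len_induct) (simp_all add: inversions_mult_S act_simple_root_not_inversion)

text \<open>The reflection in the newest inversion of ws deletes the last letter. For an older one
  induction shortens w, and restoring the last letter costs at most one.\<close>

lemma len_reflection_less:
  "w \<in> carrier W \<Longrightarrow> \<beta> \<in> inversions w \<Longrightarrow> len (root_reflection \<beta> \<otimes> w) < len w"
proof (induction arbitrary: \<beta> rule: len_induct)
  case (mult w s)
  have \<beta>: "\<beta> \<in> roots" using mult.prems by (simp add: inversions_def pos_roots_def)
  show ?case
  proof (cases "\<beta> = act w (simple_root s)")
    case True
    then have "root_reflection \<beta> \<otimes> (w \<otimes> s) = w"
      using mult.hyps by (simp add: root_reflection_act m_assoc)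
    then show ?thesis using mult.hyps by simp
  next
    case False
    with mult have "len (root_reflection \<beta> \<otimes> w) < len w" by (simp add: inversions_mult_S)
    moreover have "len (root_reflection \<beta> \<otimes> (w \<otimes> s)) \<le> len (root_reflection \<beta> \<otimes> w) + 1"
      using len_mult_le[of "root_reflection \<beta> \<otimes> w" s] len_S_le[of s] mult.hyps \<beta>
      by (simp add: m_assoc)
    ultimately show ?thesis using mult.hyps by simp
  qed
qed simp

text \<open>For the converse: s_\<beta> negates \<beta>, so if \<beta> is no inversion of w it is
  one of s_\<beta> w, and then s_\<beta> w is the longer element.\<close>

lemma inversions_iff_reflection:
  assumes w: "w \<in> carrier W" and \<beta>: "\<beta> \<in> pos_roots"
  shows "\<beta> \<in> inversions w \<longleftrightarrow> len (root_reflection \<beta> \<otimes> w) < len w"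
proof -
  have "\<beta> \<in> inversions w" if less: "len (root_reflection \<beta> \<otimes> w) < len w"
  proof (rule ccontr)
    assume not: "\<beta> \<notin> inversions w"
    let ?r = "root_reflection \<beta>"
    have r: "\<beta> \<in> roots" "?r \<in> carrier W" using \<beta> pos_roots_subset by auto
    have "?r \<otimes> ?r = \<one>" using root_reflection_cancel[of \<beta> \<one>] r by simp
    then have "inv ?r = ?r" using r by (simp add: inv_equality)
    then have "act (inv (?r \<otimes> w)) \<beta> = (\<lambda>t. - act (inv w) \<beta> t)"
      using r w by (simp add: inv_mult_group act_mult act_root_reflection_self act_neg)
    moreover have "act (inv w) \<beta> \<in> pos_roots" using not \<beta> w by (simp add: inversions_iff)
    ultimately have "neg_root (act (inv (?r \<otimes> w)) \<beta>)" by (simp add: neg_root_def)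
    then have "\<beta> \<in> inversions (?r \<otimes> w)" using \<beta> by (simp add: inversions_def)
    from len_reflection_less[OF _ this] r w less show False by simp
  qed
  with len_reflection_less w show ?thesis by blast
qed

lemma short_inversions_iff:
  "w \<in> carrier W \<Longrightarrow> \<beta> \<in> short_inversions w \<longleftrightarrow>
    \<beta> \<in> pos_roots \<and> len w = Suc (len (root_reflection \<beta> \<otimes> w))"
  by (auto simp: short_inversions_def)

lemma short_inversions_subset: "w \<in> carrier W \<Longrightarrow> short_inversions w \<subseteq> inversions w"
  by (auto simp: short_inversions_iff inversions_iff_reflection)

section \<open>The length formula, cone types and the weak order\<close>

text \<open>With \<gamma> = y \<alpha>_s, the root x^-1 \<gamma> is the image of \<alpha>_s under
  x^-1 y. Its sign decides both whether \<gamma> lies in \<Phi>(x) and whether x^-1 y s is longer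
  than x^-1 y.\<close>

lemma len_inv_mult:
  assumes x: "x \<in> carrier W" and "y \<in> carrier W"
  shows "len (inv x \<otimes> y) + 2 * card (inversions x \<inter> inversions y) = len x + len y"
  using assms(2)
proof (induction rule: len_induct)
  case one
  then show ?case using x by simp
next
  case (mult y s)
  let ?\<gamma> = "act y (simple_root s)"
  let ?w = "inv x \<otimes> y"
  have w: "?w \<in> carrier W" using x mult by simp
  have \<gamma>: "?\<gamma> \<in> pos_roots" using mult act_simple_root_pos_iff by blast
  have "?\<gamma> \<in> inversions x \<longleftrightarrow> len (?w \<otimes> s) \<noteq> Suc (len ?w)"
    using act_simple_root_pos_iff[OF w mult.hyps(2)] \<gamma> x mult.hyps by (simp add: inversions_iff act_mult)
  moreover have "len (?w \<otimes> s) = Suc (len ?w) \<or> len ?w = Suc (len (?w \<otimes> s))"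
    using len_mult_S w mult by blast
  moreover have "inv x \<otimes> (y \<otimes> s) = ?w \<otimes> s" using x mult by (simp add: m_assoc)
  moreover have "?\<gamma> \<notin> inversions y" using mult act_simple_root_not_inversion by blast
  ultimately show ?case
    using mult x by (auto simp: inversions_mult_S Int_insert_right)
qed

lemma cone_type_inv:
  assumes "x \<in> carrier W"
  shows "cone_type (inv x) = {y \<in> carrier W. inversions x \<inter> inversions y = {}}"
proof -
  have "len (inv x \<otimes> y) = len x + len y \<longleftrightarrow> inversions x \<inter> inversions y = {}" if "y \<in> carrier W" for y
    using len_inv_mult[OF assms that] assms by (auto simp: card_eq_0_iff)
  then show ?thesis using assms by (auto simp: cone_type_def)
qed

lemma weak_le_iff:
  assumes "x \<in> carrier W" "y \<in> carrier W"
  shows "weak_le x y \<longleftrightarrow> inversions x \<subseteq> inversions y"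
proof -
  have "weak_le x y \<longleftrightarrow> card (inversions x \<inter> inversions y) = card (inversions x)"
    using len_inv_mult[OF assms] assms by (auto simp: weak_le_def card_inversions)
  also have "\<dots> \<longleftrightarrow> inversions x \<inter> inversions y = inversions x"
    using assms by (metis card_subset_eq finite_inversions inf_le1)
  finally show ?thesis by blast
qed

section \<open>Boundary roots in terms of inversion sets\<close>

text \<open>Along a reduced word of w the inversion sets grow by one root at a time; the step that
  adds \<beta> is the one that leaves the cone type.\<close>

lemma boundary_rootsI:
  assumes x: "x \<in> carrier W" and "w \<in> carrier W" and "inversions x \<inter> inversions w = {\<beta>}"
  shows "\<beta> \<in> boundary_roots (cone_type (inv x))"
  using assms(2,3)
proof (induction rule: len_induct)
  case (mult w s)
  let ?\<gamma> = "act w (simple_root s)"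
  have inv: "inversions (w \<otimes> s) = insert ?\<gamma> (inversions w)" "?\<gamma> \<notin> inversions w"
    using inversions_mult_S[OF mult.hyps] act_simple_root_not_inversion[OF mult.hyps(1,2)] by blast+
  show ?case
  proof (cases "\<beta> = ?\<gamma>")
    case True
    have "\<beta> \<in> pos_roots" using mult.prems by (auto simp: inversions_def)
    \<comment> \<open>The w in the definition of boundary roots is \<open>w \<otimes> s\<close>
      here, and its neighbour in the cone type is w.\<close>
    moreover have "root_reflection \<beta> \<otimes> (w \<otimes> s) = w \<otimes> s \<otimes> s"
      using True mult.hyps by (simp add: root_reflection_act m_assoc)
    moreover have "w \<otimes> s \<notin> cone_type (inv x)" using mult.prems x by (auto simp: cone_type_inv)
    moreover have "inversions x \<inter> inversions w \<subseteq> {\<beta>}"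
      using mult.prems unfolding inv(1) by blast
    with inv(2) True have "inversions x \<inter> inversions w = {}" by fast
    then have "w \<otimes> s \<otimes> s \<in> cone_type (inv x)"
      using mult.hyps x by (simp add: cone_type_inv)
    ultimately have "\<beta> \<in> pos_roots \<and> w \<otimes> s \<notin> cone_type (inv x) \<and>
        root_reflection \<beta> \<otimes> (w \<otimes> s) = w \<otimes> s \<otimes> s \<and> w \<otimes> s \<otimes> s \<in> cone_type (inv x)"
      by (intro conjI)
    moreover have "w \<otimes> s \<in> carrier W" using mult.hyps by simp
    ultimately show ?thesis
      using mult.hyps(2) unfolding boundary_roots_def mem_Collect_eq by metis
  next
    case False
    with mult.prems inv have "inversions x \<inter> inversions w = {\<beta>}" by blast
    then show ?thesis by (rule mult.IH)
  qed
qed simp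

lemma boundary_rootsE:
  assumes x: "x \<in> carrier W" and "\<beta> \<in> boundary_roots (cone_type (inv x))"
  obtains w where "w \<in> carrier W" "inversions x \<inter> inversions w = {\<beta>}"
proof -
  obtain w s where w: "w \<in> carrier W" "s \<in> S" "w \<notin> cone_type (inv x)"
    "root_reflection \<beta> \<otimes> w = w \<otimes> s" "w \<otimes> s \<in> cone_type (inv x)" and \<beta>: "\<beta> \<in> pos_roots"
    using assms(2) by (auto simp: boundary_roots_def)
  define u where "u = w \<otimes> s"
  have u: "u \<in> carrier W" "w = u \<otimes> s" using w by (simp_all add: u_def)
  let ?\<gamma> = "act u (simple_root s)"
  have disj: "inversions x \<inter> inversions u = {}" "inversions x \<inter> inversions w \<noteq> {}"
    using w x u_def by (auto simp: cone_type_inv)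
  \<comment> \<open>Were w shorter than u, its inversions would be among those of u, which avoid
    \<Phi>(x).\<close>
  have len: "len (u \<otimes> s) = Suc (len u)"
  proof (rule ccontr)
    assume "\<not> ?thesis"
    then have "len u = Suc (len w)"
      using len_mult_S[OF u(1) w(2)] unfolding u(2)[symmetric] by blast
    then have "inversions w \<subseteq> inversions u"
      using inversions_mult_S[OF w(1,2)] unfolding u_def by blast
    with disj show False by blast
  qed
  then have inv: "inversions w = insert ?\<gamma> (inversions u)" and \<gamma>: "?\<gamma> \<in> pos_roots"
    using inversions_mult_S act_simple_root_pos_iff u w by simp_all
  \<comment> \<open>The wall equation turns s_\<beta> into usu^-1, the reflection of the one root by
    which \<Phi>(w) exceeds \<Phi>(u).\<close>
  have "root_reflection \<beta> = u \<otimes> inv w"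
    using w(1,4) \<beta> pos_roots_subset u_def u(1) by (metis inv_solve_right root_reflection_closed)
  also have "\<dots> = root_reflection ?\<gamma>"
    using u w by (simp add: root_reflection_act inv_mult_group m_assoc)
  finally have \<beta>_eq: "\<beta> = ?\<gamma>" using root_reflection_inj \<beta> \<gamma> by blast
  have "inversions x \<inter> inversions w = {\<beta>}"
    using disj unfolding inv \<beta>_eq by auto
  with w(1) show ?thesis using that by blast
qed

lemma boundary_roots_cone_type:
  assumes "x \<in> carrier W"
  shows "\<beta> \<in> boundary_roots (cone_type (inv x)) \<longleftrightarrow>
    (\<exists>w\<in>carrier W. inversions x \<inter> inversions w = {\<beta>})"
  using boundary_rootsI boundary_rootsE assms by metis

lemma boundary_roots_subset:
  assumes x: "x \<in> carrier W"
  shows "boundary_roots (cone_type (inv x)) \<subseteq> short_inversions x"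
proof
  fix \<beta> assume "\<beta> \<in> boundary_roots (cone_type (inv x))"
  then obtain w where w: "w \<in> carrier W" "inversions x \<inter> inversions w = {\<beta>}"
    using boundary_rootsE x by metis
  let ?r = "root_reflection \<beta>"
  have \<beta>: "\<beta> \<in> inversions x" "\<beta> \<in> inversions w" "\<beta> \<in> pos_roots" "\<beta> \<in> roots"
    using w by (auto simp: inversions_def pos_roots_def)
  have "len (inv x \<otimes> w) + 2 = len x + len w"
    using len_inv_mult[OF x w(1)] w(2) by simp
  moreover have "inv x \<otimes> w = inv (?r \<otimes> x) \<otimes> (?r \<otimes> w)"
  proof -
    have "?r \<otimes> x \<otimes> (inv x \<otimes> w) = ?r \<otimes> w"
      using x w \<beta> by (simp add: m_assoc)
    then show ?thesis using x w \<beta> by (simp add: inv_solve_left)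
  qed
  then have "len (inv x \<otimes> w) \<le> len (?r \<otimes> x) + len (?r \<otimes> w)"
    using len_mult_le[of "inv (?r \<otimes> x)" "?r \<otimes> w"] x w \<beta> by simp
  moreover have "len (?r \<otimes> x) < len x" "len (?r \<otimes> w) < len w"
    using len_reflection_less x w \<beta> by blast+
  \<comment> \<open>The two new lengths add up to at least \<open>len x + len w - 2\<close> and each
    drops by at least one, so each drops by exactly one.\<close>
  ultimately show "\<beta> \<in> short_inversions x"
    using x \<beta> by (simp add: short_inversions_iff)
qed

section \<open>Short inversions are extremal\<close>

definition height :: "('a \<Rightarrow> real) \<Rightarrow> real" where
  "height v = (\<Sum>s\<in>S. v s)"

lemma height_lincomb: "height (lincomb a u b v) = a * height u + b * height v"
  by (simp add: height_def lincomb_def sum.distrib sum_distrib_left)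

lemma height_pos:
  assumes "\<beta> \<in> pos_roots" shows "height \<beta> > 0"
proof -
  obtain t where "t \<in> S" "\<beta> t \<noteq> 0" using root_nonzero assms pos_roots_subset by blast
  then show ?thesis
    unfolding height_def using assms finite_S by (intro sum_pos2[of S t]) (force simp: pos_roots_def)+
qed

text \<open>A short inversion of \<open>w\<close> that is no short inversion of \<open>w s\<close> is not extremal: it lies strictly
  between the new inversion \<open>\<gamma>\<close> and \<open>- s\<^sub>\<beta> \<gamma>\<close>.\<close>

lemma short_inversion_lost:
  assumes w: "w \<in> carrier W" and s: "s \<in> S" and len: "len (w \<otimes> s) = Suc (len w)"
    and short: "\<beta> \<in> short_inversions w" and lost: "\<beta> \<notin> short_inversions (w \<otimes> s)"
  obtains c where "c > 0" "lincomb c \<beta> (- 1) (act w (simple_root s)) \<in> inversions (w \<otimes> s)"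
proof -
  let ?r = "root_reflection \<beta>"
  define \<gamma> where "\<gamma> = act w (simple_root s)"
  have \<beta>: "\<beta> \<in> pos_roots" "\<beta> \<in> roots" "\<beta> \<in> inversions w"
    using short w short_inversions_subset pos_roots_subset by (auto simp: short_inversions_def)
  have \<gamma>: "\<gamma> \<in> pos_roots" "\<gamma> \<in> roots" "\<gamma> \<notin> inversions w"
    using act_simple_root_pos_iff act_simple_root_not_inversion w s len by (simp_all add: \<gamma>_def)
  have u: "?r \<otimes> w \<in> carrier W" using w \<beta> by simp
  \<comment> \<open>As \<beta> is short for w, losing it at ws means that s_\<beta> w does not get
    longer by s; hence s_\<beta> \<gamma> is negative.\<close>
  have "len (?r \<otimes> w \<otimes> s) \<noteq> Suc (len (?r \<otimes> w))"
    using short lost w s len \<beta> by (simp add: short_inversions_iff m_assoc)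
  then have "act (?r \<otimes> w) (simple_root s) \<notin> pos_roots"
    using act_simple_root_pos_iff[OF u s] by simp
  then have neg_r\<gamma>: "neg_root (act ?r \<gamma>)"
    using w s \<beta> by (simp add: \<gamma>_def act_mult neg_root_iff)
  define c where "c = 2 * form \<gamma> \<beta>"
  define \<delta> where "\<delta> = lincomb c \<beta> (- 1) \<gamma>"
  have r\<gamma>: "act ?r \<gamma> = lincomb 1 \<gamma> (- c) \<beta>" using \<beta> \<gamma> by (simp add: act_root_reflection c_def)
  have "(\<lambda>t. - lincomb 1 \<gamma> (- c) \<beta> t) = \<delta>" by (simp add: \<delta>_def lincomb_def fun_eq_iff)
  then have \<delta>: "\<delta> \<in> pos_roots"
    using neg_r\<gamma> by (simp add: neg_root_def r\<gamma>)
  have "act ?r \<gamma> \<notin> pos_roots" using neg_r\<gamma> by (simp add: neg_root_iff)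
  then have "\<not> (\<forall>t\<in>S. 0 \<le> act ?r \<gamma> t)"
    using \<beta> \<gamma> by (simp add: pos_roots_def)
  \<comment> \<open>With c \<le> 0 all coordinates of \<gamma> - c \<beta> would be
    non-negative.\<close>
  then have c: "c > 0"
    using \<beta> \<gamma> unfolding r\<gamma> lincomb_def pos_roots_def
    by (smt (verit) mem_Collect_eq mult_nonneg_nonneg mult_1)
  let ?v = "inv (w \<otimes> s)"
  have v: "?v \<in> carrier W" using w s by simp
  have v\<gamma>: "act ?v \<gamma> = (\<lambda>t. - simple_root s t)"
    using w s by (simp add: \<gamma>_def inv_mult_group act_mult act_S simple_reflection_self)
  have "\<beta> \<in> inversions (w \<otimes> s)" using inversions_mult_S w s len \<beta> by blast
  then have neg: "(\<lambda>t. - act ?v \<beta> t) \<in> pos_roots"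
    by (simp add: inversions_def neg_root_def)
  \<comment> \<open>As (ws)^-1 sends \<gamma> to -\<alpha>_s, only \<beta> contributes to (ws)^-1
    \<delta> away from s. A coordinate other than s where (ws)^-1 \<beta> is negative therefore
    settles the sign.\<close>
  have "(\<lambda>t. - act ?v \<beta> t) \<noteq> simple_root s"
  proof
    assume "(\<lambda>t. - act ?v \<beta> t) = simple_root s"
    then have "act ?v \<beta> = act ?v \<gamma>" unfolding v\<gamma> by (metis minus_minus)
    then have "\<beta> = \<gamma>" using act_act_inv[of "w \<otimes> s"] w s \<beta> \<gamma> by (metis S_carrier m_closed roots_V)
    with \<beta> \<gamma> show False by simp
  qed
  then obtain t where t: "t \<in> S" "t \<noteq> s" "- act ?v \<beta> t > 0"
    using pos_root_other_coordinate[OF neg s] by blast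
  have "act ?v \<delta> t < 0"
    using t c v \<beta> \<gamma> v\<gamma> by (simp add: \<delta>_def act_lincomb) (simp add: lincomb_def simple_root_def mult_pos_neg)
  then have "act ?v \<delta> \<notin> pos_roots" using t(1) by (force simp: pos_roots_def)
  then have "\<delta> \<in> inversions (w \<otimes> s)" using \<delta> w s by (simp add: inversions_iff)
  with c that show ?thesis by (simp add: \<delta>_def \<gamma>_def)
qed

text \<open>Passing from w to ws, either the new root \<gamma>, which is short, attains the maximum,
  or the old maximiser \<beta> does. In the latter case \<beta> stays short: otherwise c \<beta> =
  \<gamma> + \<delta> makes its quotient a weighted mean of those of \<gamma> and \<delta>, and with
  \<gamma> strictly below, \<delta> lies above.\<close>

lemma short_inversion_maximal:
  assumes f: "\<And>a b u v. u \<in> V \<Longrightarrow> v \<in> V \<Longrightarrow> f (lincomb a u b v) = a * f u + b * f v"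
    and "w \<in> carrier W" "w \<noteq> \<one>"
  shows "\<exists>\<beta>\<in>short_inversions w. \<forall>\<alpha>\<in>inversions w. f \<alpha> / height \<alpha> \<le> f \<beta> / height \<beta>"
  using assms(2,3)
proof (induction rule: len_induct)
  case (mult w s)
  let ?\<gamma> = "act w (simple_root s)"
  let ?q = "\<lambda>\<alpha>. f \<alpha> / height \<alpha>"
  have inv: "inversions (w \<otimes> s) = insert ?\<gamma> (inversions w)" and \<gamma>: "?\<gamma> \<in> pos_roots"
    using inversions_mult_S[OF mult.hyps] act_simple_root_pos_iff[OF mult.hyps(1,2)] mult.hyps(3)
    by blast+
  have "root_reflection ?\<gamma> \<otimes> (w \<otimes> s) = w"
    using mult.hyps by (simp add: root_reflection_act m_assoc)
  then have \<gamma>_short: "?\<gamma> \<in> short_inversions (w \<otimes> s)"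
    using mult.hyps \<gamma> by (simp add: short_inversions_iff)
  show ?case
  proof (cases "\<exists>\<alpha>\<in>inversions w. ?q \<alpha> > ?q ?\<gamma>")
    case False
    with inv \<gamma>_short show ?thesis by (intro bexI[of _ ?\<gamma>]) auto
  next
    case True
    then have "w \<noteq> \<one>" by auto
    with mult.IH obtain \<beta> where \<beta>: "\<beta> \<in> short_inversions w" "\<And>\<alpha>. \<alpha> \<in> inversions w \<Longrightarrow> ?q \<alpha> \<le> ?q \<beta>"
      by blast
    have less: "?q ?\<gamma> < ?q \<beta>" using True \<beta>(2) by fastforce
    then have le: "?q \<alpha> \<le> ?q \<beta>" if "\<alpha> \<in> inversions (w \<otimes> s)" for \<alpha>
      using that \<beta>(2) unfolding inv by auto
    have "\<beta> \<in> short_inversions (w \<otimes> s)"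
    proof (rule ccontr)
      assume "\<beta> \<notin> short_inversions (w \<otimes> s)"
      then obtain c where c: "c > 0" "lincomb c \<beta> (- 1) ?\<gamma> \<in> inversions (w \<otimes> s)"
        using short_inversion_lost mult.hyps \<beta>(1) by metis
      let ?\<delta> = "lincomb c \<beta> (- 1) ?\<gamma>"
      have pos: "\<beta> \<in> pos_roots" "?\<delta> \<in> pos_roots"
        using \<beta>(1) c(2) by (auto simp: short_inversions_def inversions_def)
      \<comment> \<open>With the denominators cleared, the bounds for \<gamma> and \<delta> sum to
        less than c * k * height \<beta>, whereas linearity gives equality.\<close>
      define k where "k = ?q \<beta>"
      have "f ?\<gamma> < k * height ?\<gamma>"
        using less height_pos[OF \<gamma>] by (simp add: k_def[symmetric] pos_divide_less_eq)
      moreover have "f ?\<delta> \<le> k * height ?\<delta>"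
        using le[OF c(2)] height_pos[OF pos(2)] by (simp add: k_def[symmetric] pos_divide_le_eq)
      moreover have "f \<beta> = k * height \<beta>" using height_pos[OF pos(1)] by (simp add: k_def)
      then have "f ?\<delta> = c * (k * height \<beta>) - f ?\<gamma>" "height ?\<delta> = c * height \<beta> - height ?\<gamma>"
        using pos \<gamma> by (simp_all add: f height_lincomb)
      ultimately show False by (simp add: algebra_simps)
    qed
    with le show ?thesis by blast
  qed
qed simp

lemma inversions_subset_if_short:
  assumes x: "x \<in> carrier W" and y: "y \<in> carrier W" and sub: "short_inversions x \<subseteq> inversions y"
  shows "inversions x \<subseteq> inversions y"
proof (cases "x = \<one>")
  case False
  let ?f = "\<lambda>v. height (act (inv y) v)"
  have "?f (lincomb a u b v) = a * ?f u + b * ?f v" if "u \<in> V" "v \<in> V" for a b u v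
    using y that by (simp add: act_lincomb height_lincomb)
  from short_inversion_maximal[of ?f, OF this x False] obtain \<beta> where
    \<beta>: "\<beta> \<in> short_inversions x" "\<And>\<alpha>. \<alpha> \<in> inversions x \<Longrightarrow> ?f \<alpha> / height \<alpha> \<le> ?f \<beta> / height \<beta>"
    by blast
  have pos: "\<beta> \<in> pos_roots" and neg: "(\<lambda>t. - act (inv y) \<beta> t) \<in> pos_roots"
    using \<beta>(1) sub by (auto simp: inversions_def neg_root_def)
  \<comment> \<open>By assumption \<beta> lies in \<Phi>(y), so the maximal quotient is negative,
    and with it the quotient at every inversion of x.\<close>
  have "?f \<beta> < 0" using height_pos[OF neg] by (simp add: height_def sum_negf)
  then have neg_q: "?f \<beta> / height \<beta> < 0" using height_pos[OF pos] by (simp add: divide_neg_pos)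
  show ?thesis
  proof
    fix \<alpha> assume \<alpha>: "\<alpha> \<in> inversions x"
    then have "\<alpha> \<in> pos_roots" by (simp add: inversions_def)
    moreover have "?f \<alpha> < 0"
      using \<beta>(2)[OF \<alpha>] neg_q height_pos[OF \<open>\<alpha> \<in> pos_roots\<close>] by (smt (verit) divide_nonneg_pos)
    then have "act (inv y) \<alpha> \<notin> pos_roots" using height_pos by fastforce
    ultimately show "\<alpha> \<in> inversions y" using y by (simp add: inversions_iff)
  qed
qed simp

end

section \<open>The equivalence and the gate property\<close>

theorem proposition6p4:
  fixes W :: "('a, 'b) monoid_scheme" (structure) and S :: "'a set"
    and x :: 'a and T :: "'a set"
  assumes "coxeter_system W S" and "finite S"
    and "x \<in> carrier W"
    and "T = coxeter_system.cone_type W S (inv x)"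
  shows "(coxeter_system.ultra_low W S x \<longleftrightarrow>
            coxeter_system.short_inversions W S x = coxeter_system.boundary_roots W S T) \<and>
         (coxeter_system.short_inversions W S x = coxeter_system.boundary_roots W S T \<longrightarrow>
            coxeter_system.is_gate W S x (coxeter_system.X_part W S T))"
proof -
  interpret finite_rank_coxeter_system W S
    using assms(1,2) by (simp add: finite_rank_coxeter_system_def finite_rank_coxeter_system_axioms_def)
  have "boundary_roots T \<subseteq> short_inversions x"
    using boundary_roots_subset assms(3,4) by blast
  \<comment> \<open>Since \<partial>T consists of the \<beta> with \<Phi>(x) \<inter> \<Phi>(w) =
    {\<beta>} for some w, being ultra low is the opposite inclusion.\<close>
  then have "ultra_low x \<longleftrightarrow> short_inversions x = boundary_roots T"
    using boundary_roots_cone_type[OF assms(3)] short_inversions_subset[OF assms(3)] assms(4)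
    unfolding ultra_low_def by (auto simp: inversions_def)
  moreover have "weak_le x y" if eq: "short_inversions x = boundary_roots T" and y: "y \<in> X_part T" for y
  proof -
    have "y \<in> carrier W" "T = cone_type (inv y)" using y by (auto simp: X_part_def)
    \<comment> \<open>The inverse of y has cone type T as well, so \<partial>T also consists of
      short inversions of y.\<close>
    then have "short_inversions x \<subseteq> inversions y"
      using eq boundary_roots_subset short_inversions_subset by blast
    then show ?thesis
      using inversions_subset_if_short[OF assms(3)] weak_le_iff[OF assms(3)] \<open>y \<in> carrier W\<close> by simp
  qed
  ultimately show ?thesis
    using assms(3,4) by (auto simp: is_gate_def X_part_def)
qed

end
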